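(* Let $k$ be a field of characteristic $p>0$ and let $n\ge1$ be an integer. Then: if $1\le n\le p$, then $\mathfrak{U}_{[n,1]}^E\leadsto\mathfrak{J}_{[n,1]}^E\leadsto(\mathfrak{J}_{[n,1]}^0)^E\cup(\mathfrak{J}_{[n,1]}^1)^E$; and if $n>p$, then $\mathfrak{J}_{[n,1]}^E=\emptyset$.
   Context: $k[T]$ is the polynomial ring in one variable. $A(T)\in\mathrm{Mat}(N,k[T])$ is exponential if $A(0)=I_N$ and $A(T)A(T')=A(T+T')$ ($T,T'$ indeterminates over $k$). For $S\subset\mathrm{Mat}(N,k[T])$, $S^E$ is the set of exponential matrices in $S$. For subsets $S,S'$ of $\mathrm{Mat}(N,k[T])$, $S\leadsto S'$ means: for every $A(T)\in S$ there is $P\in GL(N,k)$ with $P^{-1}A(T)P\in S'$. $\mathfrak{U}_{[n,1]}$ is the set of upper triangular matrices $(a_{i,j}(T))\in\mathrm{Mat}(n+1,k[T])$ with all diagonal entries $1$, $a_{i,i+1}(T)\ne0$ for $1\le i\le n-1$, and $a_{n,n+1}(T)=0$. $\nu_n\in\mathrm{Mat}(n,k)$ is the nilpotent matrix with entries $1$ at positions $(i,i+1)$, $1\le i\le n-1$, and $0$ elsewhere; $\boldsymbol{e}_1$ is the first standard column vector of length $n$. For $n\ge2$, $\mathfrak{J}_{[n,1]}$ is the set of all matrices $\begin{pmatrix}I_n+\sum_{i=1}^{n-1}u_i\nu_n^i&u_n\boldsymbol{e}_1\\ \boldsymbol{0}&1\end{pmatrix}\in GL(n+1,k[T])$ with $u_1,\dots,u_n\in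 k[T]$ and $u_1\ne0$; $\mathfrak{J}_{[n,1]}^0$ is the subset with $u_n=0$, and $\mathfrak{J}_{[n,1]}^1$ is the subset for which $u_1$ and $u_n$ are linearly independent over $k$. For $n=1$ the convention is $\mathfrak{J}_{[1,1]}=\mathfrak{J}_{[1,1]}^0=\{I_2\}$, $\mathfrak{J}_{[1,1]}^1=\emptyset$. *)

theory Defs
  imports "Jordan_Normal_Form.Jordan_Normal_Form"
begin

text \<open>
  Matrices are 0-indexed here: the mathematical entry in row \<open>i\<close> and column \<open>j\<close> is
  \<open>A $$ (i - 1, j - 1)\<close>.
\<close>

text \<open>
  The ring of polynomials in two indeterminates \<open>T, T'\<close> over \<open>k\<close> is \<open>(k[T])[T']\<close>, i.e. the
  type \<open>'a poly poly\<close>; the outer variable is \<open>T'\<close>. \<open>subst2 A t\<close> is the matrix \<open>A(t)\<close>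
  for \<open>t\<close> in this ring.
\<close>

definition indet1 :: "'a::comm_ring_1 poly poly" where
  "indet1 = [:[:0, 1:]:]"

definition indet2 :: "'a::comm_ring_1 poly poly" where
  "indet2 = [:0, 1:]"

definition subst2 :: "'a::comm_ring_1 poly mat \<Rightarrow> 'a poly poly \<Rightarrow> 'a poly poly mat" where
  "subst2 A t = map_mat (\<lambda>f. poly (map_poly (\<lambda>c. [:[:c:]:]) f) t) A"

definition exponential :: "nat \<Rightarrow> 'a::comm_ring_1 poly mat \<Rightarrow> bool" where
  "exponential N A \<longleftrightarrow> A \<in> carrier_mat N N \<and>
     map_mat (\<lambda>f. poly f 0) A = 1\<^sub>m N \<and>
     subst2 A indet1 * subst2 A indet2 = subst2 A (indet1 + indet2)"

definition exp_part :: "nat \<Rightarrow> 'a::comm_ring_1 poly mat set \<Rightarrow> 'a poly mat set" where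
  "exp_part N S = {A \<in> S. exponential N A}"

text \<open>
  The relation \<open>S \<leadsto> S'\<close> between subsets of \<open>Mat(N, k[T])\<close>; \<open>Q\<close> is the inverse of \<open>P\<close>,
  and matrices over \<open>k\<close> are embedded as matrices of constant polynomials.
\<close>

definition leadsto :: "nat \<Rightarrow> 'a::comm_ring_1 poly mat set \<Rightarrow> 'a poly mat set \<Rightarrow> bool" where
  "leadsto N S S' \<longleftrightarrow> (\<forall>A\<in>S. \<exists>P Q :: 'a mat.
     P \<in> carrier_mat N N \<and> Q \<in> carrier_mat N N \<and> P * Q = 1\<^sub>m N \<and> Q * P = 1\<^sub>m N \<and>
     map_mat (\<lambda>c. [:c:]) Q * A * map_mat (\<lambda>c. [:c:]) P \<in> S')"

definition U_set :: "nat \<Rightarrow> 'a::comm_ring_1 poly mat set" where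
  "U_set n = {A \<in> carrier_mat (n + 1) (n + 1). upper_triangular A \<and>
     (\<forall>i < n + 1. A $$ (i, i) = 1) \<and>
     (\<forall>i \<in> {1..n - 1}. A $$ (i - 1, i) \<noteq> 0) \<and>
     A $$ (n - 1, n) = 0}"

text \<open>
  The nilpotent matrix \<open>\<nu>\<^sub>n\<close> is \<open>jordan_block n 0\<close>. The inner \<open>mat\<close> is
  the matrix sum \<open>u\<^sub>1 \<nu>\<^sub>n + \<dots> + u\<^sub>n\<^sub>-\<^sub>1 \<nu>\<^sub>n^(n-1)\<close>, written entrywise since matrices
  carrying their dimensions do not form a \<open>comm_monoid_add\<close>.
\<close>

definition J_mat :: "nat \<Rightarrow> (nat \<Rightarrow> 'a::comm_ring_1 poly) \<Rightarrow> 'a poly mat" where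
  "J_mat n u = four_block_mat
     (1\<^sub>m n + mat n n (\<lambda>(r, c). \<Sum>i = 1..n - 1. u i * (jordan_block n 0 ^\<^sub>m i) $$ (r, c)))
     (mat_of_cols n [u n \<cdot>\<^sub>v unit_vec n 0])
     (0\<^sub>m 1 n)
     (1\<^sub>m 1)"

text \<open>
  Linear independence of the pair \<open>(f, g)\<close> as a family (not of the set \<open>{f, g}\<close>): in
  particular \<open>(f, f)\<close> is dependent.
\<close>

definition lin_indep2 :: "'a::comm_ring_1 poly \<Rightarrow> 'a poly \<Rightarrow> bool" where
  "lin_indep2 f g \<longleftrightarrow> (\<forall>a b. Polynomial.smult a f + Polynomial.smult b g = 0 \<longrightarrow> a = 0 \<and> b = 0)"

text \<open>
  The values at \<open>n = 1\<close> are conventions.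
\<close>

definition J_set :: "nat \<Rightarrow> 'a::comm_ring_1 poly mat set" where
  "J_set n = (if n = 1 then {1\<^sub>m 2} else {J_mat n u | u. u 1 \<noteq> 0})"

definition J0_set :: "nat \<Rightarrow> 'a::comm_ring_1 poly mat set" where
  "J0_set n = (if n = 1 then {1\<^sub>m 2} else {J_mat n u | u. u 1 \<noteq> 0 \<and> u n = 0})"

definition J1_set :: "nat \<Rightarrow> 'a::comm_ring_1 poly mat set" where
  "J1_set n = (if n = 1 then {} else {J_mat n u | u. u 1 \<noteq> 0 \<and> lin_indep2 (u 1) (u n)})"

end

theory Submission
  imports Defs "HOL-Computational_Algebra.Formal_Power_Series"
begin

text \<open>
  Comparing coefficients of \<open>T'^d\<close> in \<open>A(T) A(T') = A(T') A(T)\<close> shows that an exponential \<open>A\<close>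
  commutes with each of its constant coefficient matrices. If \<open>A\<close> lies in the set \<open>U\<close>, commutativity
  also forces its superdiagonal entries to be proportional, so some coefficient matrix \<open>M\<close> has a
  superdiagonal that vanishes only in the last place. Such an \<open>M\<close> is conjugate to
  \<open>diag(\<nu>\<^sub>n, 0)\<close> by an upper triangular matrix, and a unipotent upper triangular matrix commuting
  with \<open>diag(\<nu>\<^sub>n, 0)\<close> is of the form \<open>J\<close>.

  If \<open>u\<^sub>1\<close> and \<open>u\<^sub>n\<close> are dependent, then \<open>u\<^sub>n = c u\<^sub>1\<close>, and replacing the last basis vector
  \<open>b\<close> by \<open>b - c e\<^sub>2\<close> makes \<open>u\<^sub>n\<close> vanish.

  For the emptiness statement, the upper left block of a matrix in \<open>J\<close> is a truncated power series
  \<open>F\<^sub>T = 1 + u\<^sub>1 X + \<dots>\<close> with \<open>F\<^sub>s F\<^sub>t = F\<^sub>s\<^sub>+\<^sub>t\<close> modulo \<open>X^n\<close>. Hence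
  \<open>F\<^sub>T^p = F\<^sub>p\<^sub>T = 1\<close> modulo \<open>X^n\<close>, where \<open>n > p\<close>, while
  the coefficient of \<open>X^p\<close> in \<open>F\<^sub>T^p\<close> is \<open>u\<^sub>1^p\<close>.
\<close>

section \<open>Exponential matrices\<close>

text \<open>The entrywise form of \<open>subst2\<close>. For fixed \<open>t\<close> it is a ring
  homomorphism in \<open>f\<close>, so it passes through matrix products.\<close>

definition subst_poly :: "'a::comm_ring_1 poly \<Rightarrow> 'a poly poly \<Rightarrow> 'a poly poly" where
  "subst_poly f t = poly (map_poly (\<lambda>c. [:[:c:]:]) f) t"

lemma subst2_subst_poly: "subst2 A t = map_mat (\<lambda>f. subst_poly f t) A"
  by (simp add: subst2_def subst_poly_def)

lemma comm_ring_hom_const: "comm_ring_hom (\<lambda>c::'a::comm_ring_1. [:c:])"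
  by unfold_locales (auto simp: one_pCons)

lemma comm_ring_hom_const2: "comm_ring_hom (\<lambda>c::'a::comm_ring_1. [:[:c:]:])"
  by unfold_locales (auto simp: one_pCons)

lemma comm_ring_hom_poly_map_poly:
  assumes "comm_ring_hom h"
  shows "comm_ring_hom (\<lambda>f. poly (map_poly h f) t)"
proof -
  interpret map_poly_comm_ring_hom h
    using assms by (rule map_poly_comm_ring_hom.intro)
  show ?thesis
    by unfold_locales (auto simp: hom_distribs)
qed

lemma comm_ring_hom_subst_poly: "comm_ring_hom (\<lambda>f::'a::comm_ring_1 poly. subst_poly f t)"
  unfolding subst_poly_def by (intro comm_ring_hom_poly_map_poly comm_ring_hom_const2)

lemma subst_poly_const [simp]: "subst_poly [:c:] t = [:[:c:]:]"
  by (cases "c = 0") (simp_all add: subst_poly_def)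

lemma subst_poly_0 [simp]: "subst_poly 0 t = 0"
  by (simp add: subst_poly_def)

lemma subst_poly_1 [simp]: "subst_poly 1 t = 1"
  by (simp add: one_pCons)

lemma subst_poly_at_0: "subst_poly f 0 = [:[:poly f 0:]:]"
  by (simp add: subst_poly_def poly_0_coeff_0 coeff_map_poly)

text \<open>The outer variable is T', so substituting T gives a constant, while substituting T'
  moves the coefficients of \<open>f\<close> to the outer level. Taking coefficients in T' therefore
  separates A(T) from A(T').\<close>

lemma subst_poly_indet1: "subst_poly f indet1 = [:f:]"
  by (induction f) (auto simp: subst_poly_def indet1_def)

lemma subst_poly_indet2: "subst_poly f indet2 = map_poly (\<lambda>c. [:c:]) f"
  by (induction f) (auto simp: subst_poly_def indet2_def)

lemma coeff_subst_poly_indet2: "coeff (subst_poly f indet2) d = [:coeff f d:]"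
  by (simp add: subst_poly_indet2 coeff_map_poly)

lemma hom_subst_poly:
  assumes "comm_ring_hom h" and "\<And>c. h [:[:c:]:] = [:[:c:]:]"
  shows "h (subst_poly f r) = subst_poly f (h r)"
proof -
  interpret comm_ring_hom h by fact
  have "h (subst_poly f r) = poly (map_poly h (map_poly (\<lambda>c. [:[:c:]:]) f)) (h r)"
    by (simp add: subst_poly_def)
  also have "map_poly h (map_poly (\<lambda>c. [:[:c:]:]) f) = map_poly (\<lambda>c. [:[:c:]:]) f"
    using assms(2) by (simp add: map_poly_map_poly o_def)
  finally show ?thesis by (simp add: subst_poly_def)
qed

text \<open>The defining identity in two indeterminates is generic: a homomorphism sending T to
  \<open>s\<close> and T' to \<open>t\<close> and fixing constants specializes it.\<close>

lemma exponential_subst2_add: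
  fixes A :: "'a::comm_ring_1 poly mat"
  assumes "exponential N A"
  shows "subst2 A s * subst2 A t = subst2 A (s + t)"
proof -
  \<comment> \<open>Substitutes \<open>s\<close> for T in the coefficients, then evaluates the outer
    variable at \<open>t\<close>.\<close>
  define h where "h g = poly (map_poly (\<lambda>f. subst_poly f s) g) t" for g :: "'a poly poly"
  have h: "comm_ring_hom h"
    unfolding h_def by (intro comm_ring_hom_poly_map_poly comm_ring_hom_subst_poly)
  interpret h: comm_ring_hom h by fact
  have hc: "h [:[:c:]:] = [:[:c:]:]" for c
    by (cases "c = 0") (simp_all add: h_def)
  have h1: "h indet1 = s"
    by (simp add: h_def indet1_def) (simp add: subst_poly_def flip: one_pCons)
  have h2: "h indet2 = t"
    by (simp add: h_def indet2_def map_poly_pCons flip: one_pCons)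
  have hs: "map_mat h (subst2 A r) = subst2 A (h r)" for r
    by (rule eq_matI) (auto simp: subst2_subst_poly hom_subst_poly[OF h hc])
  have A: "A \<in> carrier_mat N N"
    and eq: "subst2 A indet1 * subst2 A indet2 = subst2 A (indet1 + indet2)"
    using assms by (auto simp: exponential_def)
  have c: "subst2 A r \<in> carrier_mat N N" for r
    using A by (simp add: subst2_def)
  have "map_mat h (subst2 A indet1 * subst2 A indet2) = map_mat h (subst2 A (indet1 + indet2))"
    by (simp add: eq)
  then show ?thesis
    by (simp add: h.mat_hom_mult[OF c c] hs h1 h2 h.hom_add)
qed

section \<open>Commutation and conjugation of exponential matrices\<close>

text \<open>Since s + t = t + s, A(T) commutes with A(T'). As A(T) is constant in T', the
  coefficient of T'^d on both sides gives the claim.\<close>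

lemma exponential_commute_coeff:
  fixes A :: "'a::comm_ring_1 poly mat" and d :: nat
  assumes "exponential N A"
  defines "M \<equiv> map_mat (\<lambda>f. [:coeff f d:]) A"
  shows "A * M = M * A"
proof -
  have A: "A \<in> carrier_mat N N"
    using assms by (auto simp: exponential_def)
  have eq: "subst2 A indet1 * subst2 A indet2 = subst2 A indet2 * subst2 A indet1"
    using exponential_subst2_add[OF assms(1)] by (simp add: add.commute)
  show ?thesis
  proof (rule eq_matI)
    fix i j assume "i < dim_row (M * A)" "j < dim_col (M * A)"
    then have ij: "i < N" "j < N" using A by (auto simp: M_def)
    have "(\<Sum>l<N. [:A $$ (i, l):] * subst_poly (A $$ (l, j)) indet2) =
      (\<Sum>l<N. subst_poly (A $$ (i, l)) indet2 * [:A $$ (l, j):])"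
      using arg_cong[OF eq, of "\<lambda>X. X $$ (i, j)"] A ij
      by (simp add: subst2_subst_poly subst_poly_indet1 scalar_prod_def atLeast0LessThan)
    then have "coeff (\<Sum>l<N. [:A $$ (i, l):] * subst_poly (A $$ (l, j)) indet2) d =
      coeff (\<Sum>l<N. subst_poly (A $$ (i, l)) indet2 * [:A $$ (l, j):]) d"
      by simp
    then show "(A * M) $$ (i, j) = (M * A) $$ (i, j)"
      using A ij
      by (simp add: M_def scalar_prod_def atLeast0LessThan coeff_sum coeff_subst_poly_indet2
          mult.commute[of "subst_poly _ _"] mult.commute[of "[:_:]" "_ $$ _"])
  qed (auto simp: M_def)
qed

text \<open>Substitution fixes constant matrices, so it commutes with conjugation by them; in the
  product of two conjugates the inner \<open>P * Q\<close> cancels.\<close>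

lemma exponential_conjugate:
  fixes A :: "'a::comm_ring_1 poly mat" and P Q :: "'a mat"
  assumes "exponential N A" and P: "P \<in> carrier_mat N N" and Q: "Q \<in> carrier_mat N N"
    and PQ: "P * Q = 1\<^sub>m N" and QP: "Q * P = 1\<^sub>m N"
  shows "exponential N (map_mat (\<lambda>c. [:c:]) Q * A * map_mat (\<lambda>c. [:c:]) P)"
proof -
  let ?c = "map_mat (\<lambda>c. [:c:]) :: 'a mat \<Rightarrow> 'a poly mat"
  let ?c2 = "map_mat (\<lambda>c. [:[:c:]:]) :: 'a mat \<Rightarrow> 'a poly poly mat"
  have A: "A \<in> carrier_mat N N" and A0: "map_mat (\<lambda>f. poly f 0) A = 1\<^sub>m N"
    and AA: "subst2 A indet1 * subst2 A indet2 = subst2 A (indet1 + indet2)"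
    using assms(1) by (auto simp: exponential_def)
  interpret c2: comm_ring_hom "\<lambda>c::'a. [:[:c:]:]" by (rule comm_ring_hom_const2)
  have ev: "semiring_hom (\<lambda>f::'a poly. poly f 0)"
    by unfold_locales auto
  have cP: "?c P \<in> carrier_mat N N" and cQ: "?c Q \<in> carrier_mat N N"
    and c2P: "?c2 P \<in> carrier_mat N N" and c2Q: "?c2 Q \<in> carrier_mat N N"
    using P Q by auto
  have sA: "subst2 A t \<in> carrier_mat N N" for t
    using A by (simp add: subst2_def)
  have conj: "subst2 (?c Q * A * ?c P) t = ?c2 Q * subst2 A t * ?c2 P" for t
  proof -
    interpret s: comm_ring_hom "\<lambda>f::'a poly. subst_poly f t" by (rule comm_ring_hom_subst_poly)
    have "map_mat (\<lambda>f. subst_poly f t) (?c X) = ?c2 X" for X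
      by (rule eq_matI) auto
    then show ?thesis
      using s.mat_hom_mult[OF mult_carrier_mat[OF cQ A] cP] s.mat_hom_mult[OF cQ A]
      by (simp add: subst2_subst_poly)
  qed
  have "map_mat (\<lambda>f. poly f 0) (?c X) = X" for X
    by (rule eq_matI) auto
  then have "map_mat (\<lambda>f. poly f 0) (?c Q * A * ?c P) = 1\<^sub>m N"
    using semiring_hom.mat_hom_mult[OF ev mult_carrier_mat[OF cQ A] cP]
      semiring_hom.mat_hom_mult[OF ev cQ A] A0 Q QP
    by simp
  moreover have "subst2 (?c Q * A * ?c P) indet1 * subst2 (?c Q * A * ?c P) indet2 =
    subst2 (?c Q * A * ?c P) (indet1 + indet2)"
  proof -
    have PQ2: "?c2 P * ?c2 Q = 1\<^sub>m N"
      using c2.mat_hom_mult[OF P Q] by (simp add: PQ c2.mat_hom_one)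
    have "?c2 Q * subst2 A indet1 * ?c2 P * (?c2 Q * subst2 A indet2 * ?c2 P) =
      ?c2 Q * subst2 A indet1 * (?c2 P * ?c2 Q) * subst2 A indet2 * ?c2 P"
      using sA c2P c2Q by (simp add: assoc_mult_mat[of _ N N _ N _ N] mult_carrier_mat[of _ N N _ N])
    also have "\<dots> = ?c2 Q * (subst2 A indet1 * subst2 A indet2) * ?c2 P"
      unfolding PQ2 using right_mult_one_mat[OF mult_carrier_mat[OF c2Q sA]] assoc_mult_mat[OF c2Q sA sA]
      by simp
    finally show ?thesis by (simp add: conj AA)
  qed
  ultimately show ?thesis
    using cP cQ A by (auto simp: exponential_def)
qed

section \<open>Entries of matrices of type J\<close>

lemma J_mat_carrier: "J_mat n u \<in> carrier_mat (n + 1) (n + 1)"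
  unfolding J_mat_def carrier_mat_def by simp

text \<open>The m-th power of the shift has its ones exactly on the m-th superdiagonal, so the upper
  left block is constant along diagonals. The corner entry \<open>u n\<close> fits the same formula
  \<open>u (j - i)\<close> with \<open>i = 0\<close> and \<open>j = n\<close>.\<close>

lemma J_mat_index:
  fixes u :: "nat \<Rightarrow> 'a::comm_ring_1 poly"
  assumes "i \<le> n" "j \<le> n"
  shows "J_mat n u $$ (i, j) =
    (if i = j then 1 else if i < j \<and> (j < n \<or> i = 0) then u (j - i) else 0)"
proof -
  have "(\<Sum>m = 1..n - 1. u m * (jordan_block n 0 ^\<^sub>m m) $$ (i, j)) = (if i < j then u (j - i) else 0)"
    if "i < n" "j < n"
  proof -
    \<comment> \<open>The entries are binomial coefficients times powers of the eigenvalue 0: for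
      \<open>m < j - i\<close> the binomial vanishes, for \<open>m > j - i\<close> the power
      does.\<close>
    have pow: "(jordan_block n 0 ^\<^sub>m m) $$ (i, j) = (if i \<le> j \<and> m = j - i then 1 else 0 :: 'a poly)" for m
      using that by (cases m "j - i" rule: linorder_cases)
        (auto simp: jordan_block_pow power_0_left binomial_eq_0)
    have "(\<Sum>m = 1..n - 1. u m * (jordan_block n 0 ^\<^sub>m m) $$ (i, j)) =
      (\<Sum>m = 1..n - 1. if m = j - i then (if i < j then u (j - i) else 0) else 0)"
      using that by (intro sum.cong) (auto simp: pow)
    also have "\<dots> = (if i < j then u (j - i) else 0)"
      using that by (subst sum.delta) auto
    finally show ?thesis .
  qed
  note block = this
  consider "i < n" "j < n" | "i < n" "j = n" | "i = n"
    using assms by fastforce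
  then show ?thesis
  proof cases
    case 1
    then show ?thesis unfolding J_mat_def using block by simp
  next
    case 2
    then show ?thesis by (simp add: J_mat_def mat_of_cols_index)
  next
    case 3
    then show ?thesis using assms by (cases "j = n") (simp_all add: J_mat_def)
  qed
qed

section \<open>Matrices of type J\<close>

text \<open>Row 0, read as a truncated power series, turns addition of arguments into multiplication
  below degree \<open>n\<close>. If p < n, the coefficient in degree p is still in this range, and
  Frobenius yields the contradiction \<open>u 1 ^ p = 0\<close>.\<close>

lemma exponential_J_mat_char_le:
  fixes u :: "nat \<Rightarrow> 'a::field poly"
  assumes exp: "exponential (n + 1) (J_mat n u)" and "u 1 \<noteq> 0"
    and char: "CHAR('a) > 0"
  shows "n \<le> CHAR('a)"
proof (rule ccontr)
  assume "\<not> n \<le> CHAR('a)"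
  define p where "p = CHAR('a)"
  have pn: "p < n" using \<open>\<not> n \<le> CHAR('a)\<close> by (simp add: p_def)
  have prime: "prime p"
    unfolding p_def using char by (rule prime_CHAR_semidom)
  then have p1: "p > 1" by (rule prime_gt_1_nat)
  \<comment> \<open>The diagonal entry 1 is the coefficient in degree 0. The series is cut off at
    degree \<open>n\<close>, where the constancy along diagonals ends.\<close>
  define U where "U m = (if m = 0 then 1 else u m)" for m
  define F where "F s = Abs_fps (\<lambda>m. if m < n then subst_poly (U m) s else 0)"
    for s :: "'a poly poly"
  have mult: "fps_nth (F s * F t) m = fps_nth (F (s + t)) m" if "m < n" for s t m
  proof -
    have "(subst2 (J_mat n u) s * subst2 (J_mat n u) t) $$ (0, m) =
      subst2 (J_mat n u) (s + t) $$ (0, m)"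
      by (simp add: exponential_subst2_add[OF exp])
    then have "(\<Sum>l<n + 1. subst_poly (J_mat n u $$ (0, l)) s * subst_poly (J_mat n u $$ (l, m)) t) =
      subst_poly (U m) (s + t)"
      using that J_mat_carrier[of n u]
      by (simp add: subst2_subst_poly scalar_prod_def atLeast0LessThan J_mat_index U_def
          del: sum.lessThan_Suc)
    \<comment> \<open>The entries below the diagonal vanish, which turns the matrix product into a
      Cauchy product.\<close>
    also have "(\<Sum>l<n + 1. subst_poly (J_mat n u $$ (0, l)) s * subst_poly (J_mat n u $$ (l, m)) t) =
      (\<Sum>l=0..m. subst_poly (J_mat n u $$ (0, l)) s * subst_poly (J_mat n u $$ (l, m)) t)"
      using that by (intro sum.mono_neutral_right) (auto simp: J_mat_index)
    also have "\<dots> = (\<Sum>l=0..m. subst_poly (U l) s * subst_poly (U (m - l)) t)"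
      using that by (intro sum.cong) (auto simp: J_mat_index U_def)
    also have "\<dots> = fps_nth (F s * F t) m"
      unfolding fps_mult_nth using that by (intro sum.cong) (simp_all add: F_def)
    finally show ?thesis
      using that by (simp add: F_def)
  qed
  have F_0: "fps_nth (F 0) m = (if m = 0 then 1 else 0)" if "m < n" for m
  proof -
    have "map_mat (\<lambda>f. poly f 0) (J_mat n u) $$ (0, m) = 1\<^sub>m (n + 1) $$ (0, m)"
      using exp by (simp add: exponential_def)
    then have "poly (U m) 0 = (if m = 0 then 1 else 0)"
      using that J_mat_carrier[of n u] by (auto simp: J_mat_index U_def)
    then show ?thesis
      using that by (simp add: F_def subst_poly_at_0 one_pCons)
  qed
  \<comment> \<open>The coefficient of degree \<open>m\<close> in a product involves only degrees up
    to \<open>m\<close>, so the induction never leaves the range where \<open>mult\<close>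
    applies.\<close>
  have pow: "fps_nth (F s ^ k) m = fps_nth (F (of_nat k * s)) m" if "m < n" for s k m
    using that
  proof (induction k arbitrary: m)
    case 0
    then show ?case by (simp add: F_0)
  next
    case (Suc k)
    have "fps_nth (F s ^ Suc k) m = (\<Sum>l=0..m. fps_nth (F s) l * fps_nth (F s ^ k) (m - l))"
      by (simp add: fps_mult_nth)
    also have "\<dots> = (\<Sum>l=0..m. fps_nth (F s) l * fps_nth (F (of_nat k * s)) (m - l))"
      using Suc by (intro sum.cong) auto
    also have "\<dots> = fps_nth (F (of_nat (Suc k) * s)) m"
      using mult[OF Suc.prems, of s "of_nat k * s"] by (simp add: fps_mult_nth algebra_simps)
    finally show ?case .
  qed
  \<comment> \<open>The constant term of \<open>G\<close> is \<open>[:u 1:]\<close>, so by Frobenius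
    the coefficient of degree \<open>p\<close> in \<open>(1 + fps_X * G) ^ p\<close> is its
    \<open>p\<close>-th power.\<close>
  define G where "G = fps_shift 1 (F indet1)"
  have "F indet1 = 1 + fps_X * G"
    using pn by (intro fps_ext) (auto simp: G_def F_def U_def)
  then have "F indet1 ^ p = 1 + fps_X ^ p * G ^ p"
    using prime freshmans_dream[of p 1 "fps_X * G"]
    by (simp add: p_def semiring_char_fps semiring_char_poly power_mult_distrib)
  then have "fps_nth (F indet1 ^ p) p = [:u 1:] ^ p"
    using p1 pn
    by (simp add: fps_X_power_mult_nth fps_nth_power_0 G_def F_def U_def subst_poly_indet1)
  \<comment> \<open>In characteristic p the power is \<open>F (p * T) = F 0\<close> below degree
    \<open>n\<close>, and A(0) is the identity.\<close>
  moreover have "fps_nth (F indet1 ^ p) p = 0"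
  proof -
    have "of_nat p = (0 :: 'a poly poly)"
      using of_nat_CHAR[where 'a = "'a poly poly"] by (simp add: semiring_char_poly p_def)
    then show ?thesis
      using pow[OF pn] F_0[OF pn] p1 by simp
  qed
  ultimately show False
    using \<open>u 1 \<noteq> 0\<close> by simp
qed

text \<open>A matrix already in a target set is conjugated by the identity. Otherwise
  \<open>u n\<close> is a multiple of \<open>u 1\<close>, and a transvection clears the corner
  entry.\<close>

lemma J_set_leadsto:
  assumes "n \<ge> 1"
  shows "leadsto (n + 1) (exp_part (n + 1) (J_set n :: 'a::field poly mat set))
    (exp_part (n + 1) (J0_set n) \<union> exp_part (n + 1) (J1_set n))"
  unfolding leadsto_def
proof
  fix A :: "'a poly mat"
  assume "A \<in> exp_part (n + 1) (J_set n)"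
  then have AJ: "A \<in> J_set n" and exp: "exponential (n + 1) A"
    by (auto simp: exp_part_def)
  let ?c = "map_mat (\<lambda>c. [:c:]) :: 'a mat \<Rightarrow> 'a poly mat"
  let ?S = "exp_part (n + 1) (J0_set n) \<union> exp_part (n + 1) (J1_set n) :: 'a poly mat set"
  interpret c: comm_ring_hom "\<lambda>c::'a. [:c:]" by (rule comm_ring_hom_const)
  have A: "A \<in> carrier_mat (n + 1) (n + 1)"
    using exp by (simp add: exponential_def)
  show "\<exists>P Q. P \<in> carrier_mat (n + 1) (n + 1) \<and> Q \<in> carrier_mat (n + 1) (n + 1) \<and>
    P * Q = 1\<^sub>m (n + 1) \<and> Q * P = 1\<^sub>m (n + 1) \<and> ?c Q * A * ?c P \<in> ?S"
  proof (cases "A \<in> J0_set n \<union> J1_set n")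
    case True
    have "?c (1\<^sub>m (n + 1)) * A * ?c (1\<^sub>m (n + 1)) = A"
      using A by (simp add: c.mat_hom_one)
    then have "?c (1\<^sub>m (n + 1)) * A * ?c (1\<^sub>m (n + 1)) \<in> ?S"
      using True exp by (auto simp: exp_part_def)
    then show ?thesis
      by (intro exI[of _ "1\<^sub>m (n + 1)"] conjI) simp_all
  next
    case False
    \<comment> \<open>For \<open>n = 1\<close> the convention makes \<open>J_set\<close> and
      \<open>J0_set\<close> equal, so that case is already settled.\<close>
    then have n: "n \<ge> 2"
      using AJ assms by (cases "n = 1") (auto simp: J_set_def J0_set_def)
    then obtain u where u: "A = J_mat n u" "u 1 \<noteq> 0"
      using AJ by (auto simp: J_set_def)
    with False n have "\<not> lin_indep2 (u 1) (u n)"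
      by (auto simp: J1_set_def)
    then obtain a b where ab: "Polynomial.smult a (u 1) + Polynomial.smult b (u n) = 0"
      and ab0: "a \<noteq> 0 \<or> b \<noteq> 0"
      by (auto simp: lin_indep2_def)
    \<comment> \<open>With \<open>b = 0\<close> the relation would read \<open>a * u 1 = 0\<close>
      with \<open>a\<close> nonzero.\<close>
    have "b \<noteq> 0" using ab ab0 u by auto
    define e where "e = - a / b"
    have "Polynomial.smult b (u n) = Polynomial.smult (- a) (u 1)"
      using ab by (simp add: add_eq_0_iff)
    then have "Polynomial.smult (inverse b) (Polynomial.smult b (u n)) =
      Polynomial.smult (inverse b) (Polynomial.smult (- a) (u 1))"
      by simp
    then have un: "u n = Polynomial.smult e (u 1)"
      using \<open>b \<noteq> 0\<close> by (simp add: e_def field_simps)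
    \<comment> \<open>Right multiplication by \<open>E x\<close> adds \<open>x\<close> times column
      1 to column \<open>n\<close>; these are different columns since
      \<open>n \<ge> 2\<close>.\<close>
    define E where "E x = mat (n + 1) (n + 1)
      (\<lambda>(i, j). if i = j then 1 else if i = 1 \<and> j = n then x else 0)" for x :: 'a
    have E: "E x \<in> carrier_mat (n + 1) (n + 1)" for x
      by (simp add: E_def)
    have EM: "(X * ?c (E x)) $$ (i, j) = X $$ (i, j) + (if j = n then X $$ (i, 1) * [:x:] else 0)"
      if "X \<in> carrier_mat (n + 1) (n + 1)" "i \<le> n" "j \<le> n" for X x i j
    proof -
      have "(X * ?c (E x)) $$ (i, j) = (\<Sum>l<n + 1. X $$ (i, l) *
        [:if l = j then 1 else if l = 1 \<and> j = n then x else 0:])"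
        using that by (auto simp: E_def scalar_prod_def atLeast0LessThan intro!: sum.cong)
      also have "\<dots> = (\<Sum>l<n + 1. (if l = j then X $$ (i, l) else 0) +
        (if l = 1 then if j = n then X $$ (i, l) * [:x:] else 0 else 0))"
        using n by (intro sum.cong) (auto simp flip: one_pCons)
      also have "\<dots> = X $$ (i, j) + (if j = n then X $$ (i, 1) * [:x:] else 0)"
        using that n by (simp add: sum.distrib del: sum.lessThan_Suc)
      finally show ?thesis .
    qed
    have cE: "?c (E x) \<in> carrier_mat (n + 1) (n + 1)" for x
      by (simp add: E_def)
    have inv: "E x * E (- x) = 1\<^sub>m (n + 1)" for x
    proof -
      have "?c (E x) * ?c (E (- x)) = ?c (1\<^sub>m (n + 1))"
      proof (rule eq_matI)
        fix i j assume "i < dim_row (?c (1\<^sub>m (n + 1)))" "j < dim_col (?c (1\<^sub>m (n + 1)))"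
        then show "(?c (E x) * ?c (E (- x))) $$ (i, j) = ?c (1\<^sub>m (n + 1)) $$ (i, j)"
          using n by (subst EM[OF cE]) (auto simp: E_def simp flip: one_pCons)
      qed (auto simp: E_def)
      then have "?c (E x * E (- x)) = ?c (1\<^sub>m (n + 1))"
        by (simp add: c.mat_hom_mult[OF E E])
      then show ?thesis
        using E by (auto simp: mat_eq_iff)
    qed
    have inv': "E (- e) * E e = 1\<^sub>m (n + 1)"
      using inv[of "- e"] by simp
    define v where "v = u(n := 0)"
    have v: "J_mat n v \<in> carrier_mat (n + 1) (n + 1)" by (rule J_mat_carrier)
    \<comment> \<open>On the left, column \<open>n\<close> becomes \<open>u n - e * u 1 = 0\<close>
      in row 0 and \<open>- e\<close> in row 1. On the right, row 1 gains \<open>- e\<close> times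
      row \<open>n\<close>, which is a unit vector, so the same \<open>- e\<close> appears.\<close>
    have AE: "A * ?c (E (- e)) = ?c (E (- e)) * J_mat n v"
    proof (rule eq_matI)
      fix i j assume "i < dim_row (?c (E (- e)) * J_mat n v)" "j < dim_col (?c (E (- e)) * J_mat n v)"
      then have ij: "i \<le> n" "j \<le> n"
        using v E[of "- e"] by auto
      have "(?c (E (- e)) * J_mat n v) $$ (i, j) = (\<Sum>l<n + 1.
        [:if i = l then 1 else if i = 1 \<and> l = n then - e else 0:] * J_mat n v $$ (l, j))"
        using ij v by (auto simp: E_def scalar_prod_def atLeast0LessThan intro!: sum.cong)
      also have "\<dots> = (\<Sum>l<n + 1. (if i = l then J_mat n v $$ (l, j) else 0) +
        (if l = n then if i = 1 then [:- e:] * J_mat n v $$ (l, j) else 0 else 0))"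
        using n by (intro sum.cong) (auto simp flip: one_pCons)
      also have "\<dots> = J_mat n v $$ (i, j) + (if i = 1 then [:- e:] * J_mat n v $$ (n, j) else 0)"
        using ij n by (simp add: sum.distrib del: sum.lessThan_Suc)
      finally show "(A * ?c (E (- e))) $$ (i, j) = (?c (E (- e)) * J_mat n v) $$ (i, j)"
        unfolding EM[OF A ij] using ij n by (auto simp: u(1) J_mat_index v_def un)
    qed (use A v E[of "- e"] in auto)
    have "?c (E e) * A * ?c (E (- e)) = ?c (E e) * (?c (E (- e)) * J_mat n v)"
      using assoc_mult_mat[OF cE A cE] by (simp add: AE)
    also have "\<dots> = ?c (E e * E (- e)) * J_mat n v"
      by (simp add: c.mat_hom_mult[OF E E] assoc_mult_mat[OF cE cE v])
    also have "\<dots> = J_mat n v"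
      using v by (simp add: inv c.mat_hom_one)
    finally have *: "?c (E e) * A * ?c (E (- e)) = J_mat n v" .
    have "exponential (n + 1) (J_mat n v)"
      using exponential_conjugate[OF exp E E inv' inv] unfolding * .
    moreover have "J_mat n v \<in> J0_set n"
    proof -
      have "v 1 \<noteq> 0 \<and> v n = 0" using n u(2) by (simp add: v_def)
      then have "J_mat n v \<in> {J_mat n u |u. u 1 \<noteq> 0 \<and> u n = 0}" by blast
      then show ?thesis using n by (simp add: J0_set_def)
    qed
    ultimately have "?c (E e) * A * ?c (E (- e)) \<in> ?S"
      unfolding * by (simp add: exp_part_def)
    then show ?thesis
      by (intro exI[of _ "E (- e)"] exI[of _ "E e"] conjI E inv' inv)
  qed
qed

section \<open>Nilpotent matrices with superdiagonal vanishing only in the last place\<close>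

text \<open>Back substitution starting from the last unit vector, which rows \<open>n - 1\<close>
  and \<open>n\<close> already annihilate because of \<open>last\<close>. Each row above is solved
  for the unknown at its nonzero superdiagonal entry.\<close>

lemma almost_regular_nilpotent_kernel:
  fixes m :: "nat \<Rightarrow> nat \<Rightarrow> 'a::field"
  assumes lower: "\<And>i j. j \<le> i \<Longrightarrow> m i j = 0"
    and super: "\<And>i. Suc i < n \<Longrightarrow> m i (Suc i) \<noteq> 0"
    and last: "m (n - 1) n = 0" and n: "n \<ge> 1"
  obtains w where "w n = 1" "\<And>i. i \<le> n \<Longrightarrow> (\<Sum>l\<le>n. m i l * w l) = 0"
proof -
  have "\<exists>w. w n = 1 \<and> (\<forall>i. n - 1 - k \<le> i \<and> i \<le> n \<longrightarrow> (\<Sum>l\<le>n. m i l * w l) = 0)" if "k < n" for k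
    using that
  proof (induction k)
    case 0
    have "(\<Sum>l\<le>n. m i l * (if l = n then 1 else 0)) = 0" if "n - 1 \<le> i" "i \<le> n" for i
    proof -
      have "i = n - 1 \<or> i = n" using that by auto
      then show ?thesis using last lower by (intro sum.neutral) auto
    qed
    then show ?case by (intro exI[of _ "\<lambda>l. if l = n then 1 else 0"]) auto
  next
    case (Suc k)
    then obtain w where w: "w n = 1" "\<And>i. n - 1 - k \<le> i \<Longrightarrow> i \<le> n \<Longrightarrow> (\<Sum>l\<le>n. m i l * w l) = 0"
      by auto
    define r where "r = n - 1 - Suc k"
    have r: "Suc r = n - 1 - k" "Suc r < n" using Suc.prems by (auto simp: r_def)
    \<comment> \<open>Row \<open>r\<close> is solved for the unknown with index
      \<open>Suc r\<close>. The rows below involve only larger indices, so they stay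
      satisfied.\<close>
    define w' where "w' = w(Suc r := - (\<Sum>l\<in>{..n} - {Suc r}. m r l * w l) / m r (Suc r))"
    have "(\<Sum>l\<le>n. m i l * w' l) = 0" if "r \<le> i" "i \<le> n" for i
    proof (cases "i = r")
      case True
      have "(\<Sum>l\<le>n. m r l * w' l) = m r (Suc r) * w' (Suc r) + (\<Sum>l\<in>{..n} - {Suc r}. m r l * w' l)"
        using r by (intro sum.remove) auto
      also have "(\<Sum>l\<in>{..n} - {Suc r}. m r l * w' l) = (\<Sum>l\<in>{..n} - {Suc r}. m r l * w l)"
        by (intro sum.cong) (auto simp: w'_def)
      finally show ?thesis
        using True super[OF r(2)] by (simp add: w'_def)
    next
      case False
      then have "Suc r \<le> i" using that by auto
      have "(\<Sum>l\<le>n. m i l * w' l) = (\<Sum>l\<le>n. m i l * w l)"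
        using \<open>Suc r \<le> i\<close> lower by (intro sum.cong) (auto simp: w'_def)
      then show ?thesis using w(2) \<open>Suc r \<le> i\<close> that r by simp
    qed
    moreover have "w' n = 1" using w r by (simp add: w'_def)
    ultimately show ?case unfolding r_def by blast
  qed
  from this[of "n - 1"] n show ?thesis
    using that by auto
qed

lemma upper_triangular_invertible:
  fixes P :: "'a::field mat"
  assumes P: "P \<in> carrier_mat N N" and "upper_triangular P"
    and diag: "\<And>i. i < N \<Longrightarrow> P $$ (i, i) \<noteq> 0"
  obtains Q where "Q \<in> carrier_mat N N" "P * Q = 1\<^sub>m N" "Q * P = 1\<^sub>m N"
proof -
  have "det P \<noteq> 0"
    using upper_triangular_imp_det_eq_0_iff[OF P assms(2)] P diag
    by (auto simp: diag_mat_def)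
  from det_non_zero_imp_unit[OF P this, of "()"] show ?thesis
    using that by (auto simp: Units_def ring_mat_def)
qed

text \<open>The matrix diag(\<nu>, 0): the condition \<open>j < n\<close> removes the last
  superdiagonal one. It is generic in the ring because it occurs both over k and over k[T].\<close>

definition nil_mat :: "nat \<Rightarrow> 'a::comm_ring_1 mat" where
  "nil_mat n = mat (n + 1) (n + 1) (\<lambda>(i, j). if j = Suc i \<and> j < n then 1 else 0)"

lemma nil_mat_carrier: "nil_mat n \<in> carrier_mat (n + 1) (n + 1)"
  by (simp add: nil_mat_def)

lemma times_nil_mat_index:
  assumes "A \<in> carrier_mat (n + 1) (n + 1)" "i \<le> n" "j \<le> n"
  shows "(A * nil_mat n) $$ (i, j) = (if 1 \<le> j \<and> j < n then A $$ (i, j - 1) else 0)"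
proof -
  have "(A * nil_mat n) $$ (i, j) = (\<Sum>l<n + 1. A $$ (i, l) * (if j = Suc l \<and> j < n then 1 else 0))"
    using assms by (simp add: nil_mat_def scalar_prod_def atLeast0LessThan del: sum.lessThan_Suc)
  also have "\<dots> = (\<Sum>l<n + 1. if l = j - 1 then if 1 \<le> j \<and> j < n then A $$ (i, l) else 0 else 0)"
    by (intro sum.cong refl) auto
  also have "\<dots> = (if 1 \<le> j \<and> j < n then A $$ (i, j - 1) else 0)"
    using assms by (subst sum.delta) auto
  finally show ?thesis .
qed

lemma nil_mat_times_index:
  assumes "A \<in> carrier_mat (n + 1) (n + 1)" "i \<le> n" "j \<le> n"
  shows "(nil_mat n * A) $$ (i, j) = (if Suc i < n then A $$ (Suc i, j) else 0)"
proof -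
  have "(nil_mat n * A) $$ (i, j) = (\<Sum>l<n + 1. (if l = Suc i \<and> l < n then 1 else 0) * A $$ (l, j))"
    using assms by (simp add: nil_mat_def scalar_prod_def atLeast0LessThan del: sum.lessThan_Suc)
  also have "\<dots> = (\<Sum>l<n + 1. if l = Suc i then if Suc i < n then A $$ (l, j) else 0 else 0)"
    by (intro sum.cong refl) auto
  also have "\<dots> = (if Suc i < n then A $$ (Suc i, j) else 0)"
    by (subst sum.delta) auto
  finally show ?thesis .
qed

text \<open>A Jordan basis in triangular form: the chain of length \<open>n\<close> generated by the
  unit vector with index \<open>n - 1\<close>, followed by a kernel vector with last entry
  1.\<close>

lemma almost_regular_nilpotent_normal_form:
  fixes M :: "'a::field mat"
  assumes M: "M \<in> carrier_mat (n + 1) (n + 1)"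
    and lower: "\<And>i j. j \<le> i \<Longrightarrow> i \<le> n \<Longrightarrow> M $$ (i, j) = 0"
    and super: "\<And>i. Suc i < n \<Longrightarrow> M $$ (i, Suc i) \<noteq> 0"
    and last: "M $$ (n - 1, n) = 0" and n: "n \<ge> 1"
  obtains P where "P \<in> carrier_mat (n + 1) (n + 1)" "upper_triangular P"
    "\<And>i. i \<le> n \<Longrightarrow> P $$ (i, i) \<noteq> 0" "M * P = P * nil_mat n"
proof -
  \<comment> \<open>Extension by zero past row \<open>n\<close> makes strict triangularity hold for
    all indices.\<close>
  define m where "m i j = (if i \<le> n then M $$ (i, j) else 0)" for i j
  have lower': "m i j = 0" if "j \<le> i" for i j
    using that lower by (auto simp: m_def)
  obtain w where w: "w n = 1" "\<And>i. i \<le> n \<Longrightarrow> (\<Sum>l\<le>n. m i l * w l) = 0"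
    using almost_regular_nilpotent_kernel[of m n] lower' super last n by (auto simp: m_def)
  \<comment> \<open>\<open>g k\<close> is the vector \<open>M^k e\<close> for the basis vector \<open>e\<close> with index \<open>n - 1\<close>.\<close>
  define g where "g = rec_nat (\<lambda>i. if i = n - 1 then 1 else 0) (\<lambda>k v i. \<Sum>l\<le>n. m i l * v l)"
  have g_0: "g 0 i = (if i = n - 1 then 1 else 0)" for i
    by (simp add: g_def)
  have g_Suc: "g (Suc k) i = (\<Sum>l\<le>n. m i l * g k l)" for k i
    by (simp add: g_def)
  have g_zero: "g k i = 0" if "i + k \<ge> n" for k i
    using that
  proof (induction k arbitrary: i)
    case 0
    then show ?case using n by (auto simp: g_0)
  next
    case (Suc k)
    have "m i l * g k l = 0" for l
      using Suc by (cases "l \<le> i") (simp_all add: lower')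
    then show ?case unfolding g_Suc by (intro sum.neutral) blast
  qed
  \<comment> \<open>The last nonzero entry of the \<open>k\<close>-th chain vector is a product of
    superdiagonal entries.\<close>
  have g_nonzero: "g k i \<noteq> 0" if "i + k = n - 1" for k i
    using that
  proof (induction k arbitrary: i)
    case 0
    then show ?case by (simp add: g_0)
  next
    case (Suc k)
    have z: "m i l * g k l = 0" if "l \<noteq> Suc i" for l
    proof (cases "l \<le> i")
      case False
      then have "g k l = 0" using that Suc.prems by (intro g_zero) auto
      then show ?thesis by simp
    qed (simp add: lower')
    have "g (Suc k) i = (\<Sum>l\<le>n. if l = Suc i then m i l * g k l else 0)"
      unfolding g_Suc by (intro sum.cong) (auto simp: z)
    then have "g (Suc k) i = m i (Suc i) * g k (Suc i)"
      using Suc.prems by simp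
    then show ?case
      using Suc super[of i] by (simp add: m_def)
  qed
  \<comment> \<open>The chain is listed in reverse, so that its last nonzero entries lie on the
    diagonal of \<open>P\<close>.\<close>
  define P where "P = mat (n + 1) (n + 1) (\<lambda>(i, j). if j < n then g (n - 1 - j) i else w i)"
  have P: "P \<in> carrier_mat (n + 1) (n + 1)" by (simp add: P_def)
  show ?thesis
  proof (rule that[OF P])
    show "upper_triangular P"
      by (rule upper_triangularI) (auto simp: P_def intro!: g_zero)
    show "P $$ (i, i) \<noteq> 0" if "i \<le> n" for i
      using that w(1) by (auto simp: P_def intro!: g_nonzero)
    show "M * P = P * nil_mat n"
    proof (rule eq_matI)
      fix i j assume "i < dim_row (P * nil_mat n)" "j < dim_col (P * nil_mat n)"
      then have ij: "i \<le> n" "j \<le> n" using P by (auto simp: nil_mat_def)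
      have "(M * P) $$ (i, j) = (\<Sum>l\<le>n. m i l * P $$ (l, j))"
        using ij M P
        by (auto simp: scalar_prod_def atLeast0LessThan m_def lessThan_Suc_atMost
            simp del: sum.lessThan_Suc sum.atMost_Suc intro!: sum.cong)
      \<comment> \<open>Applying \<open>M\<close> moves column \<open>j\<close> to column
        \<open>j - 1\<close>; column 0 goes to \<open>g n\<close>, which is zero.\<close>
      also have "\<dots> = (if j < n then g (Suc (n - 1 - j)) i else 0)"
        using ij w by (auto simp: P_def g_Suc)
      also have "\<dots> = (P * nil_mat n) $$ (i, j)"
        unfolding times_nil_mat_index[OF P ij] using ij
        by (cases j) (auto simp: P_def g_zero Suc_diff_Suc)
      finally show "(M * P) $$ (i, j) = (P * nil_mat n) $$ (i, j)" .
    qed (use M P in \<open>auto simp: nil_mat_def\<close>)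
  qed
qed

section \<open>Conjugation into type J\<close>

text \<open>For \<open>Suc i < n\<close>, commutation expresses row \<open>Suc i\<close> as row
  \<open>i\<close> shifted right, with zeros in columns 0 and \<open>n\<close>. So row 0 determines
  all rows up to \<open>n - 1\<close>, and \<open>last\<close> supplies row
  \<open>n\<close>.\<close>

lemma commute_nil_mat_imp_J_mat:
  fixes B :: "'a::comm_ring_1 poly mat"
  assumes B: "B \<in> carrier_mat (n + 1) (n + 1)" and n: "n \<ge> 2"
    and comm: "B * nil_mat n = nil_mat n * B"
    and B00: "B $$ (0, 0) = 1"
    and last: "\<And>j. j \<le> n \<Longrightarrow> B $$ (n, j) = (if j = n then 1 else 0)"
  shows "B = J_mat n (\<lambda>i. B $$ (0, i))"
proof -
  have entry: "(if 1 \<le> j \<and> j < n then B $$ (i, j - 1) else 0) = (if Suc i < n then B $$ (Suc i, j) else 0)"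
    if "i \<le> n" "j \<le> n" for i j
    using arg_cong[OF comm, of "\<lambda>X. X $$ (i, j)"] that
    by (simp add: times_nil_mat_index[OF B] nil_mat_times_index[OF B])
  have main: "B $$ (i, j) = J_mat n (\<lambda>i. B $$ (0, i)) $$ (i, j)" if "i < n" "j \<le> n" for i j
    using that
  proof (induction i arbitrary: j)
    case 0
    then show ?case using B00 by (auto simp: J_mat_index)
  next
    case (Suc i)
    then show ?case
      using entry[of i j] n by (auto simp: J_mat_index split: if_splits)
  qed
  show ?thesis
  proof (rule eq_matI)
    fix i j assume "i < dim_row (J_mat n (\<lambda>i. B $$ (0, i)))" "j < dim_col (J_mat n (\<lambda>i. B $$ (0, i)))"
    then have "i \<le> n" "j \<le> n" using J_mat_carrier[of n "\<lambda>i. B $$ (0, i)"] by auto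
    then show "B $$ (i, j) = J_mat n (\<lambda>i. B $$ (0, i)) $$ (i, j)"
      using main[of i j] last[of j] by (cases "i = n") (auto simp: J_mat_index)
  qed (use B J_mat_carrier[of n "\<lambda>i. B $$ (0, i)"] in auto)
qed

section \<open>Coefficient matrices of exponential matrices in \<open>U_set\<close>\<close>

text \<open>A degree \<open>d\<close> occurring in the first superdiagonal entry occurs in the
  others before the last one as well, because commutation with the coefficient matrix makes
  neighbouring entries proportional.\<close>

lemma exponential_U_set_coeff:
  fixes A :: "'a::field poly mat"
  assumes U: "A \<in> U_set n" and exp: "exponential (n + 1) A" and n: "n \<ge> 2"
  obtains d where "d > 0" "\<And>i. Suc i < n \<Longrightarrow> coeff (A $$ (i, Suc i)) d \<noteq> 0"
proof -
  have A: "A \<in> carrier_mat (n + 1) (n + 1)" and ut: "upper_triangular A"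
    and diag: "\<And>i. i \<le> n \<Longrightarrow> A $$ (i, i) = 1"
    using U by (auto simp: U_set_def)
  have super: "A $$ (i, Suc i) \<noteq> 0" if "Suc i < n" for i
  proof -
    have "\<forall>i\<in>{1..n - 1}. A $$ (i - 1, i) \<noteq> 0"
      using U unfolding U_set_def by blast
    from bspec[OF this, of "Suc i"] show ?thesis using that by auto
  qed
  have lower: "A $$ (i, j) = 0" if "j < i" "i \<le> n" for i j
    using upper_triangularD[OF ut that(1)] that A by auto
  have "A $$ (0, 1) \<noteq> 0" using super[of 0] n by simp
  then obtain d where d: "coeff (A $$ (0, 1)) d \<noteq> 0"
    by (auto simp: poly_eq_iff)
  have "map_mat (\<lambda>f. poly f 0) A $$ (0, 1) = 1\<^sub>m (n + 1) $$ (0, 1)"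
    using exp by (simp add: exponential_def)
  \<comment> \<open>Off-diagonal entries of A(0) vanish, which excludes degree 0. Positivity of
    \<open>d\<close> in turn makes the diagonal of \<open>M\<close> zero, as that of
    \<open>A\<close> is constant.\<close>
  then have "d > 0"
    using d n A by (cases d) (auto simp: poly_0_coeff_0)
  define M where "M = map_mat (\<lambda>f. [:coeff f d:]) A"
  have M: "M \<in> carrier_mat (n + 1) (n + 1)" using A by (simp add: M_def)
  have Mlow: "M $$ (i, j) = 0" if "j \<le> i" "i \<le> n" for i j
    using that A lower[of j i] diag[of i] \<open>d > 0\<close> by (cases "i = j") (auto simp: M_def)
  have comm: "A * M = M * A"
    unfolding M_def by (rule exponential_commute_coeff[OF exp])
  have two_terms: "(X * Y) $$ (i, Suc (Suc i)) = X $$ (i, i) * Y $$ (i, Suc (Suc i)) +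
      X $$ (i, Suc i) * Y $$ (Suc i, Suc (Suc i)) + X $$ (i, Suc (Suc i)) * Y $$ (Suc (Suc i), Suc (Suc i))"
    if X: "X \<in> carrier_mat (n + 1) (n + 1)" and Y: "Y \<in> carrier_mat (n + 1) (n + 1)"
      and "\<And>i j. j < i \<Longrightarrow> i \<le> n \<Longrightarrow> X $$ (i, j) = 0" "\<And>i j. j < i \<Longrightarrow> i \<le> n \<Longrightarrow> Y $$ (i, j) = 0"
      and "Suc (Suc i) \<le> n"
    for X Y :: "'a poly mat" and i
  proof -
    have "(X * Y) $$ (i, Suc (Suc i)) = (\<Sum>l<n + 1. X $$ (i, l) * Y $$ (l, Suc (Suc i)))"
      using that by (simp add: scalar_prod_def atLeast0LessThan del: sum.lessThan_Suc)
    also have "\<dots> = (\<Sum>l\<in>{i, Suc i, Suc (Suc i)}. X $$ (i, l) * Y $$ (l, Suc (Suc i)))"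
    proof (intro sum.mono_neutral_right ballI)
      fix l assume "l \<in> {..<n + 1} - {i, Suc i, Suc (Suc i)}"
      then have "l < i \<or> Suc (Suc i) < l" "l \<le> n" by auto
      then show "X $$ (i, l) * Y $$ (l, Suc (Suc i)) = 0"
        using that by auto
    qed (use that in auto)
    finally show ?thesis by (simp add: add.assoc)
  qed
  have "coeff (A $$ (i, Suc i)) d \<noteq> 0" if "Suc i < n" for i
    using that
  proof (induction i)
    case 0
    then show ?case using d by simp
  next
    case (Suc i)
    \<comment> \<open>In entry \<open>(i, i + 2)\<close> of \<open>A * M = M * A\<close> the
      diagonal of \<open>A\<close> is 1 and that of \<open>M\<close> is 0, so
      \<open>M $$ (i, i + 2)\<close> cancels.\<close>
    have "A $$ (i, Suc i) * M $$ (Suc i, Suc (Suc i)) = M $$ (i, Suc i) * A $$ (Suc i, Suc (Suc i))"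
      using arg_cong[OF comm, of "\<lambda>X. X $$ (i, Suc (Suc i))"] Suc.prems lower Mlow diag
        two_terms[OF A M, of i] two_terms[OF M A, of i] by simp
    moreover have "M $$ (i, Suc i) * A $$ (Suc i, Suc (Suc i)) \<noteq> 0"
      using Suc super[of "Suc i"] A by (simp add: M_def)
    ultimately have "M $$ (Suc i, Suc (Suc i)) \<noteq> 0" by auto
    then show ?case using A Suc.prems by (simp add: M_def)
  qed
  with \<open>d > 0\<close> show ?thesis by (rule that)
qed

text \<open>\<open>P\<close> brings a coefficient matrix \<open>M\<close> to the form
  \<open>nil_mat\<close>. Since \<open>A\<close> commutes with \<open>M\<close>, the conjugate
  \<open>B\<close> of \<open>A\<close> commutes with \<open>nil_mat\<close>, which forces type J
  once row \<open>n\<close> and the corner entry are known.\<close>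

lemma exponential_U_set_conjugate:
  fixes A :: "'a::field poly mat"
  assumes U: "A \<in> U_set n" and exp: "exponential (n + 1) A" and n: "n \<ge> 2"
  obtains P Q :: "'a mat"
  where "P \<in> carrier_mat (n + 1) (n + 1)" "Q \<in> carrier_mat (n + 1) (n + 1)"
    "P * Q = 1\<^sub>m (n + 1)" "Q * P = 1\<^sub>m (n + 1)"
    "map_mat (\<lambda>c. [:c:]) Q * A * map_mat (\<lambda>c. [:c:]) P \<in> J_set n"
proof -
  let ?N = "n + 1"
  let ?c = "map_mat (\<lambda>c. [:c:]) :: 'a mat \<Rightarrow> 'a poly mat"
  interpret c: comm_ring_hom "\<lambda>c::'a. [:c:]" by (rule comm_ring_hom_const)
  note assoc = assoc_mult_mat[of _ ?N ?N _ ?N _ ?N] mult_carrier_mat[of _ ?N ?N _ ?N]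
  have A: "A \<in> carrier_mat ?N ?N" and ut: "upper_triangular A"
    and diag: "\<And>i. i \<le> n \<Longrightarrow> A $$ (i, i) = 1" and last: "A $$ (n - 1, n) = 0"
    using U by (auto simp: U_set_def)
  have lower: "A $$ (i, j) = 0" if "j < i" "i \<le> n" for i j
    using upper_triangularD[OF ut that(1)] that A by auto
  obtain d where d: "d > 0" "\<And>i. Suc i < n \<Longrightarrow> coeff (A $$ (i, Suc i)) d \<noteq> 0"
    by (rule exponential_U_set_coeff[OF U exp n]) blast
  define M where "M = map_mat (\<lambda>f. coeff f d) A"
  have M: "M \<in> carrier_mat ?N ?N" using A by (simp add: M_def)
  have Mlow: "M $$ (i, j) = 0" if "j \<le> i" "i \<le> n" for i j
    using that A lower[of j i] diag[of i] d(1) by (cases "i = j") (auto simp: M_def)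
  have cM_eq: "?c M = map_mat (\<lambda>f. [:coeff f d:]) A"
    by (rule eq_matI) (auto simp: M_def)
  have AM: "A * ?c M = ?c M * A"
    unfolding cM_eq by (rule exponential_commute_coeff[OF exp])
  obtain P where P: "P \<in> carrier_mat ?N ?N" and Put: "upper_triangular P"
    and Pdiag: "\<And>i. i \<le> n \<Longrightarrow> P $$ (i, i) \<noteq> 0" and MP: "M * P = P * nil_mat n"
    using almost_regular_nilpotent_normal_form[OF M Mlow] d(2) A last n
    by (auto simp: M_def)
  have Plow: "P $$ (i, j) = 0" if "j < i" "i \<le> n" for i j
    using upper_triangularD[OF Put that(1)] that P by auto
  obtain Q where Q: "Q \<in> carrier_mat ?N ?N" and PQ: "P * Q = 1\<^sub>m ?N" and QP: "Q * P = 1\<^sub>m ?N"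
    by (rule upper_triangular_invertible[OF P Put]) (use Pdiag in auto)
  have D: "(nil_mat n :: 'a mat) \<in> carrier_mat ?N ?N" by (rule nil_mat_carrier)
  have "Q * M = Q * M * (P * Q)"
    using Q M by (simp add: PQ)
  also have "\<dots> = Q * (M * P) * Q"
    using P Q M by (simp add: assoc)
  also have "\<dots> = Q * P * nil_mat n * Q"
    unfolding MP using P Q D by (simp add: assoc)
  finally have QM: "Q * M = nil_mat n * Q"
    using Q D by (simp add: QP)
  define B where "B = ?c Q * A * ?c P"
  have cP: "?c P \<in> carrier_mat ?N ?N" and cQ: "?c Q \<in> carrier_mat ?N ?N"
    and cM: "?c M \<in> carrier_mat ?N ?N"
    using P Q M by auto
  have B: "B \<in> carrier_mat ?N ?N" unfolding B_def by (rule mult_carrier_mat[OF mult_carrier_mat[OF cQ A] cP])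
  have cD: "?c (nil_mat n) = nil_mat n"
    by (rule eq_matI) (auto simp: nil_mat_def)
  have D': "(nil_mat n :: 'a poly mat) \<in> carrier_mat ?N ?N" by (rule nil_mat_carrier)
  have cMP: "?c M * ?c P = ?c P * nil_mat n"
    using arg_cong[OF MP, of ?c] by (simp add: c.mat_hom_mult[OF M P] c.mat_hom_mult[OF P D] cD)
  have cQM: "?c Q * ?c M = nil_mat n * ?c Q"
    using arg_cong[OF QM, of ?c] by (simp add: c.mat_hom_mult[OF Q M] c.mat_hom_mult[OF D Q] cD)
  have "B * nil_mat n = ?c Q * A * (?c P * nil_mat n)"
    unfolding B_def using cP cQ A D' by (simp add: assoc)
  also have "\<dots> = ?c Q * (A * ?c M) * ?c P"
    unfolding cMP[symmetric] using cP cQ A cM by (simp add: assoc)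
  also have "\<dots> = (?c Q * ?c M) * A * ?c P"
    unfolding AM using cP cQ A cM by (simp add: assoc)
  also have "\<dots> = nil_mat n * B"
    unfolding cQM B_def using cP cQ A D' by (simp add: assoc)
  finally have BD: "B * nil_mat n = nil_mat n * B" .
  have cPQ: "?c P * ?c Q = 1\<^sub>m ?N"
    using arg_cong[OF PQ, of ?c] by (simp add: c.mat_hom_mult[OF P Q] c.mat_hom_one)
  \<comment> \<open>Entries of \<open>B\<close> are read off from \<open>P * B = A * P\<close>,
    where both known factors are upper triangular.\<close>
  have "?c P * B = (?c P * ?c Q) * (A * ?c P)"
    unfolding B_def using cP cQ A by (simp add: assoc)
  then have PB: "?c P * B = A * ?c P"
    using left_mult_one_mat[OF mult_carrier_mat[OF A cP]] by (simp add: cPQ)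
  have PB_index: "(\<Sum>l<?N. [:P $$ (i, l):] * B $$ (l, j)) = (\<Sum>l<?N. A $$ (i, l) * [:P $$ (l, j):])"
    if "i \<le> n" "j \<le> n" for i j
    using arg_cong[OF PB, of "\<lambda>X. X $$ (i, j)"] that P A B
    by (simp add: scalar_prod_def atLeast0LessThan del: sum.lessThan_Suc)
  have single: "(\<Sum>l<?N. f l) = f i" if "i \<le> n" "\<And>l. l \<le> n \<Longrightarrow> l \<noteq> i \<Longrightarrow> f l = 0"
    for f :: "nat \<Rightarrow> 'a poly" and i
    using that by (subst sum.mono_neutral_right[of _ "{i}"]) auto
  have cancel: "b = 1" if "[:c:] * b = [:c:]" "c \<noteq> 0" for c :: 'a and b
    using that mult_left_cancel[of "[:c:]" b 1] by simp
  have Bn: "B $$ (n, j) = (if j = n then 1 else 0)" if "j \<le> n" for j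
  proof -
    have "(\<Sum>l<?N. [:P $$ (n, l):] * B $$ (l, j)) = [:P $$ (n, n):] * B $$ (n, j)"
      using Plow by (intro single) auto
    moreover have "(\<Sum>l<?N. A $$ (n, l) * [:P $$ (l, j):]) = A $$ (n, n) * [:P $$ (n, j):]"
      using lower by (intro single) auto
    ultimately have "[:P $$ (n, n):] * B $$ (n, j) = [:P $$ (n, j):]"
      using PB_index[of n j] that diag[of n] by simp
    then show ?thesis
      using Pdiag[of n] Plow[of j n] that cancel[of "P $$ (n, n)"] by (cases "j = n") auto
  qed
  \<comment> \<open>Column 0 of \<open>B * nil_mat n\<close> is zero, while that of
    \<open>nil_mat n * B\<close> contains the entries of \<open>B\<close> in rows 1 to
    \<open>n - 1\<close>.\<close>
  have B_col0: "B $$ (i, 0) = 0" if "0 < i" "i \<le> n" for i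
  proof (cases "i = n")
    case False
    then show ?thesis
      using arg_cong[OF BD, of "\<lambda>X. X $$ (i - 1, 0)"] that
      by (simp add: times_nil_mat_index[OF B] nil_mat_times_index[OF B])
  qed (use Bn n in auto)
  have B00: "B $$ (0, 0) = 1"
  proof -
    have "(\<Sum>l<?N. [:P $$ (0, l):] * B $$ (l, 0)) = [:P $$ (0, 0):] * B $$ (0, 0)"
      using B_col0 by (intro single) auto
    moreover have "(\<Sum>l<?N. A $$ (0, l) * [:P $$ (l, 0):]) = A $$ (0, 0) * [:P $$ (0, 0):]"
      using Plow by (intro single) auto
    ultimately have "[:P $$ (0, 0):] * B $$ (0, 0) = [:P $$ (0, 0):]"
      using PB_index[of 0 0] diag[of 0] by simp
    then show ?thesis
      using Pdiag[of 0] by (intro cancel) auto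
  qed
  define u where "u = (\<lambda>i. B $$ (0, i))"
  have BJ: "B = J_mat n u"
    unfolding u_def using commute_nil_mat_imp_J_mat[OF B n BD B00 Bn] .
  \<comment> \<open>If \<open>u 1\<close> vanished, column 1 of \<open>B\<close> would be a unit
    vector, and entry \<open>(0, 1)\<close> of \<open>P * B = A * P\<close> would give
    \<open>A $$ (0, 1) * P $$ (1, 1) = 0\<close>.\<close>
  have "u 1 \<noteq> 0"
  proof
    assume "u 1 = 0"
    then have Bl1: "B $$ (l, 1) = (if l = 1 then 1 else 0)" if "l \<le> n" for l
      using that n by (auto simp: BJ J_mat_index)
    have "[:P $$ (0, 1):] = [:P $$ (0, 1):] * B $$ (1, 1)"
      using Bl1[of 1] n by simp
    also have "\<dots> = (\<Sum>l<?N. [:P $$ (0, l):] * B $$ (l, 1))"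
      using n Bl1 by (intro single[symmetric]) auto
    also have "\<dots> = (\<Sum>l<?N. A $$ (0, l) * [:P $$ (l, 1):])"
      using PB_index[of 0 1] n by simp
    also have "\<dots> = (\<Sum>l\<in>{0, 1}. A $$ (0, l) * [:P $$ (l, 1):])"
      using n Plow[of 1] by (intro sum.mono_neutral_right) auto
    also have "\<dots> = [:P $$ (0, 1):] + A $$ (0, 1) * [:P $$ (1, 1):]"
      using diag[of 0] by simp
    finally have "A $$ (0, 1) * [:P $$ (1, 1):] = 0"
      by simp
    then show False
      using Pdiag[of 1] d(2)[of 0] n by auto
  qed
  then have "B \<in> J_set n"
    using BJ n by (auto simp: J_set_def)
  then show ?thesis
    using that[OF P Q PQ QP] by (simp add: B_def)
qed

text \<open>For \<open>n = 1\<close> the only matrix in \<open>U_set\<close> is the identity, the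
  conventional element of \<open>J_set\<close>. For larger \<open>n\<close> the conjugate found
  above is again exponential.\<close>

lemma U_set_leadsto:
  assumes "n \<ge> 1"
  shows "leadsto (n + 1) (exp_part (n + 1) (U_set n :: 'a::field poly mat set))
    (exp_part (n + 1) (J_set n))"
  unfolding leadsto_def
proof
  fix A :: "'a poly mat"
  assume "A \<in> exp_part (n + 1) (U_set n)"
  then have U: "A \<in> U_set n" and exp: "exponential (n + 1) A"
    by (auto simp: exp_part_def)
  have "\<exists>P Q :: 'a mat. P \<in> carrier_mat (n + 1) (n + 1) \<and> Q \<in> carrier_mat (n + 1) (n + 1) \<and>
    P * Q = 1\<^sub>m (n + 1) \<and> Q * P = 1\<^sub>m (n + 1) \<and>
    map_mat (\<lambda>c. [:c:]) Q * A * map_mat (\<lambda>c. [:c:]) P \<in> J_set n"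
  proof (cases "n = 1")
    case True
    interpret c: comm_ring_hom "\<lambda>c::'a. [:c:]" by (rule comm_ring_hom_const)
    have A: "A \<in> carrier_mat 2 2" using exp True by (simp add: exponential_def numeral_2_eq_2)
    have "A = 1\<^sub>m 2"
    proof (rule eq_matI)
      fix i j assume "i < dim_row (1\<^sub>m 2)" "j < dim_col (1\<^sub>m 2)"
      then show "A $$ (i, j) = 1\<^sub>m 2 $$ (i, j)"
        using U True A by (auto simp: U_set_def less_2_cases_iff)
    qed (use A in auto)
    then have "map_mat (\<lambda>c. [:c:]) (1\<^sub>m (n + 1)) * A * map_mat (\<lambda>c. [:c:]) (1\<^sub>m (n + 1)) \<in> J_set n"
      using True by (simp add: c.mat_hom_one J_set_def numeral_2_eq_2)
    then show ?thesis
      by (intro exI[of _ "1\<^sub>m (n + 1)"] conjI) auto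
  next
    case False
    then have "n \<ge> 2" using assms by simp
    show ?thesis
      by (rule exponential_U_set_conjugate[OF U exp \<open>n \<ge> 2\<close>]) blast
  qed
  then obtain P Q :: "'a mat"
    where PQ: "P \<in> carrier_mat (n + 1) (n + 1)" "Q \<in> carrier_mat (n + 1) (n + 1)"
      "P * Q = 1\<^sub>m (n + 1)" "Q * P = 1\<^sub>m (n + 1)"
    and J: "map_mat (\<lambda>c. [:c:]) Q * A * map_mat (\<lambda>c. [:c:]) P \<in> J_set n"
    by blast
  from J exponential_conjugate[OF exp PQ]
  have "map_mat (\<lambda>c. [:c:]) Q * A * map_mat (\<lambda>c. [:c:]) P \<in> exp_part (n + 1) (J_set n)"
    unfolding exp_part_def by simp
  with PQ show "\<exists>P Q. P \<in> carrier_mat (n + 1) (n + 1) \<and> Q \<in> carrier_mat (n + 1) (n + 1) \<and>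
    P * Q = 1\<^sub>m (n + 1) \<and> Q * P = 1\<^sub>m (n + 1) \<and>
    map_mat (\<lambda>c. [:c:]) Q * A * map_mat (\<lambda>c. [:c:]) P \<in> exp_part (n + 1) (J_set n)"
    by blast
qed

theorem corollary1p22:
  fixes n p :: nat
  assumes "CHAR('a::field) = p" and "p > 0" and "n \<ge> 1"
  shows "(n \<le> p \<longrightarrow>
            leadsto (n + 1) (exp_part (n + 1) (U_set n :: 'a poly mat set))
              (exp_part (n + 1) (J_set n)) \<and>
            leadsto (n + 1) (exp_part (n + 1) (J_set n :: 'a poly mat set))
              (exp_part (n + 1) (J0_set n) \<union> exp_part (n + 1) (J1_set n))) \<and>
         (n > p \<longrightarrow> exp_part (n + 1) (J_set n :: 'a poly mat set) = {})"
proof (intro conjI impI)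
  assume "n > p"
  show "exp_part (n + 1) (J_set n :: 'a poly mat set) = {}"
  proof (rule ccontr)
    assume "exp_part (n + 1) (J_set n :: 'a poly mat set) \<noteq> {}"
    \<comment> \<open>From \<open>n > p\<close> and \<open>p > 0\<close> follows
      \<open>n > 1\<close>, so the convention for \<open>n = 1\<close> is not in force.\<close>
    then obtain u :: "nat \<Rightarrow> 'a poly" where "exponential (n + 1) (J_mat n u)" "u 1 \<noteq> 0"
      using \<open>n > p\<close> assms(2) by (auto simp: exp_part_def J_set_def split: if_splits)
    from exponential_J_mat_char_le[OF this] assms \<open>n > p\<close> show False
      by simp
  qed
qed (use U_set_leadsto J_set_leadsto assms(3) in blast)+

end
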